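(* For all integers $k\geq 1$, $d\geq 0$ and $L\ge 0$, \[ \mathbb{E}\bigl[P_d(L)-P_0(L)\bigr]\leq d\sqrt{\frac{2L}{k}}+d . \]
   Context: Let $[k]=\{1,\dots,k\}$. A subsequence of a word is obtained by deleting some (not necessarily contiguous) symbols. For words $u,u'$ and an integer $d\ge 0$, write $u\prec_d u'$ if one can remove at most $d$ symbols from $u$ and obtain a subsequence of $u'$. For a word $u$, $u_{<m}$ denotes its prefix of length $m$. Let $w$ and $w'$ be two independent infinite random words whose symbols are independent and uniform on $[k]$. For integers $d,L\ge 0$ put \[ P_d(L)=\max\{m : w_{<m}\prec_d w'_{<L}\} \] (the same $w,w'$ are used for all $d$). *)

theory Defs
  imports "HOL-Probability.Probability" "HOL-Library.Sublist"
begin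

definition almost_subseq :: "nat \<Rightarrow> 'a list \<Rightarrow> 'a list \<Rightarrow> bool" where
  "almost_subseq d u u' \<longleftrightarrow> (\<exists>v. subseq v u \<and> length u - length v \<le> d \<and> subseq v u')"

definition word_prefix :: "nat \<Rightarrow> (nat \<Rightarrow> 'a) \<Rightarrow> 'a list" where
  "word_prefix m u = map u [0..<m]"

definition match_length :: "nat \<Rightarrow> nat \<Rightarrow> (nat \<Rightarrow> 'a) \<Rightarrow> (nat \<Rightarrow> 'a) \<Rightarrow> nat" where
  "match_length d L u u' = Max {m. almost_subseq d (word_prefix m u) (word_prefix L u')}"

text \<open>The set in the definition of \<open>P\<close> is finite and contains \<open>0\<close>, so its \<open>Max\<close> is meaningful.\<close>

lemma match_length_set_nonempty: "0 \<in> {m. almost_subseq d (word_prefix m u) (word_prefix L u')}"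
  by (auto simp: almost_subseq_def word_prefix_def intro: exI[of _ "[]"])

lemma match_length_set_finite: "finite {m. almost_subseq d (word_prefix m u) (word_prefix L u')}"
proof (rule finite_subset)
  show "{m. almost_subseq d (word_prefix m u) (word_prefix L u')} \<subseteq> {..L + d}"
    by (auto simp: almost_subseq_def word_prefix_def dest!: list_emb_length)
qed simp

end

theory Submission
  imports Defs
begin

text \<open>
  Reveal \<open>w'\<close> one symbol at a time. Each \<open>P\<^sub>d\<close> advances by at most one per step, and does advance
  when the new symbol equals the symbol of \<open>w\<close> at position \<open>P\<^sub>d\<close>. For \<open>X = P\<^sub>d\<^sub>+\<^sub>1 - P\<^sub>d - 1 \<ge> 0\<close>, let \<open>I\<close>
  and \<open>J\<close> indicate that the new symbol agrees with \<open>w\<close> at \<open>P\<^sub>d\<^sub>+\<^sub>1\<close> and at \<open>P\<^sub>d\<close>. Then the new value of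
  \<open>X\<^sup>2\<close> is at most \<open>X\<^sup>2 + 2 X (I - J) + I + J\<close>. Given the past, \<open>I\<close> and \<open>J\<close> both have mean \<open>1/k\<close>, so
  \<open>E X\<^sup>2\<close> grows by at most \<open>2/k\<close> per step, whence \<open>E X \<le> sqrt (2L/k)\<close>; summing the gaps over the
  number of deletions gives the claim.
\<close>

section \<open>Almost-subsequences of words extended at the right end\<close>

lemma subseq_snoc_iff:
  "subseq v (x @ [c]) \<longleftrightarrow> subseq v x \<or> (\<exists>v'. v = v' @ [c] \<and> subseq v' x)"
proof -
  have "subseq z [c] \<longleftrightarrow> z = [] \<or> z = [c]" for z :: "'a list"
    by (cases z) auto
  then show ?thesis
    by (auto simp: subseq_append_iff)
qed

lemma almost_subseq_snoc_delete:
  assumes "almost_subseq d x y"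
  shows "almost_subseq (Suc d) (x @ [c]) y"
  using assms unfolding almost_subseq_def by (fastforce simp: subseq_snoc_iff)

lemma almost_subseq_snoc_match:
  assumes "almost_subseq d x y"
  shows "almost_subseq d (x @ [c]) (y @ [c])"
proof -
  from assms obtain v where "subseq v x" "length x - length v \<le> d" "subseq v y"
    by (auto simp: almost_subseq_def)
  then show ?thesis
    unfolding almost_subseq_def by (intro exI[of _ "v @ [c]"]) (auto simp: subseq_snoc_iff)
qed

lemma almost_subseq_snoc_right:
  assumes "almost_subseq d x y"
  shows "almost_subseq d x (y @ [c])"
  using assms by (auto simp: almost_subseq_def)

lemma almost_subseq_snocD:
  assumes "almost_subseq d (x @ [c]) y"
  shows "almost_subseq d x y"
proof -
  from assms obtain v where v: "subseq v (x @ [c])" "Suc (length x) - length v \<le> d" "subseq v y"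
    by (auto simp: almost_subseq_def)
  from v(1) consider "subseq v x" | v' where "v = v' @ [c]" "subseq v' x"
    by (auto simp: subseq_snoc_iff)
  then show ?thesis
  proof cases
    case 1
    then show ?thesis using v by (auto simp: almost_subseq_def)
  next
    case 2
    then have "subseq v' y"
      using v(3) subseq_order.trans[of v' "v' @ [c]" y] by (auto simp: subseq_rev_drop_many)
    then show ?thesis using 2 v by (auto simp: almost_subseq_def)
  qed
qed

text \<open>Take a common subsequence \<open>v\<close>. If it already embeds in \<open>y\<close>,
  only \<open>c\<close> has to be dropped. If it ends in the final \<open>a\<close>, dropping that
  symbol shortens \<open>v\<close> and \<open>x @ [c]\<close> alike, so the deletion count is
  unchanged.\<close>

lemma almost_subseq_snoc_snocD:
  assumes "almost_subseq d (x @ [c]) (y @ [a])"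
  shows "almost_subseq d x y"
proof -
  from assms obtain v where v: "subseq v (x @ [c])" "Suc (length x) - length v \<le> d"
      "subseq v (y @ [a])"
    by (auto simp: almost_subseq_def)
  from v(3) consider "subseq v y" | v' where "v = v' @ [a]" "subseq v' y"
    by (auto simp: subseq_snoc_iff)
  then show ?thesis
  proof cases
    case 1
    then have "almost_subseq d (x @ [c]) y"
      using v by (auto simp: almost_subseq_def)
    then show ?thesis by (rule almost_subseq_snocD)
  next
    case 2
    have "subseq v' x"
      using v(1) 2 subseq_order.trans[of v' "v' @ [a]" x]
      by (auto simp: subseq_snoc_iff subseq_rev_drop_many)
    then show ?thesis using 2 v by (auto simp: almost_subseq_def)
  qed
qed

text \<open>If \<open>c\<close> is deleted, it uses up one deletion and leaves \<open>d\<close> of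
  them for \<open>x\<close>. If \<open>c\<close> is kept, it cannot be matched with
  \<open>a\<close>, so \<open>a\<close> is of no use.\<close>

lemma almost_subseq_snoc_snoc_neqD:
  assumes "almost_subseq (Suc d) (x @ [c]) (y @ [a])" and "c \<noteq> a"
  shows "almost_subseq d x (y @ [a]) \<or> almost_subseq (Suc d) (x @ [c]) y"
proof -
  from assms obtain v where v: "subseq v (x @ [c])" "Suc (length x) - length v \<le> Suc d"
      "subseq v (y @ [a])"
    by (auto simp: almost_subseq_def)
  from v(1) consider "subseq v x" | v' where "v = v' @ [c]" "subseq v' x"
    by (auto simp: subseq_snoc_iff)
  then show ?thesis
  proof cases
    case 1
    then have "length x - length v \<le> d"
      using v(2) by (auto dest: list_emb_length)
    then show ?thesis using 1 v by (auto simp: almost_subseq_def)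
  next
    case 2
    then have "subseq v y"
      using v(3) \<open>c \<noteq> a\<close> by (auto simp: subseq_snoc_iff)
    then show ?thesis using v by (auto simp: almost_subseq_def)
  qed
qed

section \<open>The matched length as a moving front: locality, order and one-step moves\<close>

lemma word_prefix_Suc: "word_prefix (Suc m) u = word_prefix m u @ [u m]"
  by (simp add: word_prefix_def)

lemma almost_subseq_word_prefix_mono:
  assumes "almost_subseq d (word_prefix n u) y" and "m \<le> n"
  shows "almost_subseq d (word_prefix m u) y"
  using assms(2,1)
  by (induction rule: inc_induct) (auto simp: word_prefix_Suc dest: almost_subseq_snocD)

text \<open>The admissible \<open>m\<close> form a finite nonempty set that is closed downwards, so
  being admissible and being at most the maximum coincide. Bounds on fronts reduce to prefixes
  through this.\<close>

lemma le_match_length_iff: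
  "m \<le> match_length d L u u' \<longleftrightarrow> almost_subseq d (word_prefix m u) (word_prefix L u')"
proof
  assume "m \<le> match_length d L u u'"
  moreover have "almost_subseq d (word_prefix (match_length d L u u') u) (word_prefix L u')"
    using Max_in[OF match_length_set_finite] match_length_set_nonempty
    unfolding match_length_def by blast
  ultimately show "almost_subseq d (word_prefix m u) (word_prefix L u')"
    using almost_subseq_word_prefix_mono by blast
next
  assume "almost_subseq d (word_prefix m u) (word_prefix L u')"
  then show "m \<le> match_length d L u u'"
    unfolding match_length_def by (intro Max_ge match_length_set_finite) simp
qed

lemma match_length_le: "match_length d L u u' \<le> L + d"
proof -
  have "almost_subseq d (word_prefix (match_length d L u u') u) (word_prefix L u')"
    by (simp flip: le_match_length_iff)
  then show ?thesis
    by (auto simp: almost_subseq_def word_prefix_def dest!: list_emb_length)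
qed

text \<open>Values above the bound of \<open>match_length_le\<close> are never reached, so later
  symbols of \<open>u\<close> have no influence. This makes the front a function of finitely many
  random symbols.\<close>

lemma match_length_cong:
  assumes "\<And>n. n < L + d \<Longrightarrow> u n = v n" and "\<And>n. n < L \<Longrightarrow> u' n = v' n"
  shows "match_length d L u u' = match_length d L v v'"
proof -
  have "word_prefix L u' = word_prefix L v'"
    using assms(2) by (simp add: word_prefix_def)
  moreover have "word_prefix m u = word_prefix m v" if "m \<le> L + d" for m
    using assms(1) that by (simp add: word_prefix_def)
  ultimately have "m \<le> match_length d L u u' \<longleftrightarrow> m \<le> match_length d L v v'" if "m \<le> L + d" for m
    using that by (simp add: le_match_length_iff)
  then show ?thesis
    by (meson antisym match_length_le order_refl)
qed

lemma match_length_0_right: "match_length d 0 u u' = d"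
proof (rule antisym)
  show "match_length d 0 u u' \<le> d"
    using match_length_le[of d 0 u u'] by simp
  show "d \<le> match_length d 0 u u'"
    by (auto simp: le_match_length_iff almost_subseq_def word_prefix_def)
qed

text \<open>The extra deletion skips the symbol at which the front with \<open>d\<close> deletions
  stops. Strictness is what allows \<open>match_gap\<close> to subtract 1: it stays nonnegative and
  counts the symbols strictly between the two fronts.\<close>

lemma match_length_less_Suc: "match_length d L u u' < match_length (Suc d) L u u'"
proof -
  have "almost_subseq d (word_prefix (match_length d L u u') u) (word_prefix L u')"
    by (simp flip: le_match_length_iff)
  then have "Suc (match_length d L u u') \<le> match_length (Suc d) L u u'"
    by (simp add: le_match_length_iff word_prefix_Suc almost_subseq_snoc_delete)
  then show ?thesis by simp
qed

text \<open>Below: keep an optimal match, and extend it by the new symbol if that fits. Above: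
  remove the last symbol of both words.\<close>

lemma match_length_Suc_bounds:
  "match_length d L u u' + of_bool (u' L = u (match_length d L u u')) \<le> match_length d (Suc L) u u'"
  "match_length d (Suc L) u u' \<le> Suc (match_length d L u u')"
proof -
  let ?p = "match_length d L u u'"
  have p: "almost_subseq d (word_prefix ?p u) (word_prefix L u')"
    by (simp flip: le_match_length_iff)
  have "?p \<le> match_length d (Suc L) u u'"
    using almost_subseq_snoc_right[OF p] by (simp add: le_match_length_iff word_prefix_Suc)
  moreover have "Suc ?p \<le> match_length d (Suc L) u u'" if "u' L = u ?p"
    using almost_subseq_snoc_match[OF p] that by (simp add: le_match_length_iff word_prefix_Suc)
  ultimately show "?p + of_bool (u' L = u ?p) \<le> match_length d (Suc L) u u'"
    by auto
  show "match_length d (Suc L) u u' \<le> Suc ?p"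
  proof (cases "match_length d (Suc L) u u'")
    case (Suc m)
    then have "almost_subseq d (word_prefix (Suc m) u) (word_prefix (Suc L) u')"
      by (metis le_match_length_iff order_refl)
    then have "m \<le> ?p"
      by (auto simp: le_match_length_iff word_prefix_Suc dest: almost_subseq_snoc_snocD)
    then show ?thesis using Suc by simp
  qed simp
qed

text \<open>If the front with \<open>Suc d\<close> deletions advances without a match at its own position, then
  the symbol there was deleted, so it was pushed by the adjacent front with \<open>d\<close> deletions.\<close>

lemma match_length_Suc_advance:
  assumes "match_length (Suc d) (Suc L) u u' = Suc (match_length (Suc d) L u u')"
    and "u' L \<noteq> u (match_length (Suc d) L u u')"
  shows "match_length (Suc d) L u u' = Suc (match_length d L u u')"
    and "match_length d (Suc L) u u' = Suc (match_length d L u u')"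
proof -
  let ?q = "match_length (Suc d) L u u'"
  have "almost_subseq (Suc d) (word_prefix (Suc ?q) u) (word_prefix (Suc L) u')"
    using assms(1) by (simp flip: le_match_length_iff)
  moreover have "\<not> almost_subseq (Suc d) (word_prefix (Suc ?q) u) (word_prefix L u')"
    by (simp flip: le_match_length_iff)
  ultimately have "almost_subseq d (word_prefix ?q u) (word_prefix (Suc L) u')"
    using assms(2) almost_subseq_snoc_snoc_neqD[of d "word_prefix ?q u" "u ?q" "word_prefix L u'" "u' L"]
    by (auto simp: word_prefix_Suc)
  then have "?q \<le> match_length d (Suc L) u u'"
    by (simp add: le_match_length_iff)
  then show "?q = Suc (match_length d L u u')"
    and "match_length d (Suc L) u u' = Suc (match_length d L u u')"
    using match_length_less_Suc[of d L u u'] match_length_Suc_bounds(2)[of d L u u'] by auto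
qed

section \<open>The gap between adjacent fronts\<close>

definition match_gap :: "nat \<Rightarrow> nat \<Rightarrow> (nat \<Rightarrow> 'a) \<Rightarrow> (nat \<Rightarrow> 'a) \<Rightarrow> real" where
  "match_gap d L u u' = real (match_length (Suc d) L u u') - real (match_length d L u u') - 1"

lemma match_gap_nonneg: "0 \<le> match_gap d L u u'"
  using match_length_less_Suc[of d L u u'] by (simp add: match_gap_def)

lemma match_gap_le: "match_gap d L u u' \<le> real (L + d)"
  using match_length_le[of "Suc d" L u u'] by (simp add: match_gap_def)

lemma match_gap_0_right: "match_gap d 0 u u' = 0"
  by (simp add: match_gap_def match_length_0_right)

text \<open>The leading front moves without a hit only if pushed by the trailing one, which requires
  gap 0 and moves both. For a positive gap the new gap is thus at most \<open>X + I - J\<close>; for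
  gap 0 that expression may be negative, and the bound \<open>I\<close> takes its place.\<close>

lemma match_gap_Suc_square_le:
  fixes u u' :: "nat \<Rightarrow> 'a" and d L :: nat
  defines "I \<equiv> of_bool (u' L = u (match_length (Suc d) L u u'))"
    and "J \<equiv> of_bool (u' L = u (match_length d L u u'))"
  shows "(match_gap d (Suc L) u u')\<^sup>2
    \<le> (match_gap d L u u')\<^sup>2 + 2 * (match_gap d L u u' * I - match_gap d L u u' * J) + I + J"
proof -
  define p q p' q' where pq: "p = match_length d L u u'" "q = match_length (Suc d) L u u'"
    "p' = match_length d (Suc L) u u'" "q' = match_length (Suc d) (Suc L) u u'"
  define X X' where X: "X = match_gap d L u u'" "X' = match_gap d (Suc L) u u'"
  have Xpq: "X = real q - real p - 1" "X' = real q' - real p' - 1"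
    by (simp_all add: X pq match_gap_def)
  have X'0: "0 \<le> X'" by (simp add: X match_gap_nonneg)
  have bounds: "real p + J \<le> real p'" "real p' \<le> real p + 1"
      "real q + I \<le> real q'" "real q' \<le> real q + 1"
    using match_length_Suc_bounds[of d L u u'] match_length_Suc_bounds[of "Suc d" L u u']
    unfolding pq I_def J_def by (auto simp: of_bool_def split: if_splits)
  have IJ: "I = 0 \<or> I = 1" "J = 0 \<or> J = 1"
    by (auto simp: I_def J_def)
  have adv: "q' = q \<or> I = 1 \<or> q = Suc p \<and> p' = Suc p"
  proof -
    have "q' = q \<or> q' = Suc q" using bounds IJ by auto
    then show ?thesis
      using match_length_Suc_advance[of d L u u'] by (auto simp: pq I_def)
  qed
  have "X'\<^sup>2 \<le> X\<^sup>2 + 2 * (X * I - X * J) + I + J"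
  proof (cases "X = 0")
    case True
    then have "X' \<le> I" using adv bounds IJ Xpq by auto
    then have "X'\<^sup>2 \<le> I\<^sup>2" using X'0 by (intro power_mono)
    then show ?thesis using True IJ by auto
  next
    case False
    then have "real q' = real q + I" using adv bounds IJ Xpq by auto
    then have "X' \<le> X + I - J" using bounds Xpq by simp
    then have "X'\<^sup>2 \<le> (X + I - J)\<^sup>2" using X'0 by (intro power_mono)
    \<comment> \<open>For indicators, \<open>(I - J)\<^sup>2 = I + J - 2 * I * J\<close>. The
      products \<open>X * I\<close> and \<open>X * J\<close> stay separate because their
      expectations are computed separately.\<close>
    also have "\<dots> \<le> X\<^sup>2 + 2 * (X * I - X * J) + I + J"
      using IJ by (auto simp: power2_eq_square algebra_simps)
    finally show ?thesis .
  qed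
  then show ?thesis by (simp add: X)
qed

section \<open>Hitting a random target with an independent uniform symbol\<close>

lemma borel_measurable_of_bool_eq [measurable (raw)]:
  fixes X Y :: "'a \<Rightarrow> nat"
  assumes [measurable]: "X \<in> measurable M (count_space UNIV)" "Y \<in> measurable M (count_space UNIV)"
  shows "(\<lambda>\<omega>. of_bool (X \<omega> = Y \<omega>) :: real) \<in> borel_measurable M"
proof -
  \<comment> \<open>The equality event is a countable union over the common value.\<close>
  have "Measurable.pred M (\<lambda>\<omega>. \<exists>n. X \<omega> = n \<and> Y \<omega> = n)"
    by measurable
  then have "Measurable.pred M (\<lambda>\<omega>. X \<omega> = Y \<omega>)"
    by (simp add: eq_commute)
  then show ?thesis
    unfolding of_bool_def by measurable
qed

text \<open>The target \<open>g (Y \<omega>)\<close> is random but determined by \<open>Y\<close>.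
  Splitting by its value \<open>c\<close> leaves products of a function of \<open>Y\<close> and the
  event \<open>h (Z \<omega>) = c\<close>, which is independent of \<open>Y\<close> and has
  probability \<open>1 / k\<close>. By \<open>range\<close>, the values \<open>c\<close> in the
  alphabet exhaust all cases almost surely.\<close>

lemma (in prob_space) expectation_indep_uniform_hit:
  fixes f :: "'b \<Rightarrow> real" and g h :: "'b \<Rightarrow> nat" and k :: nat
  assumes indep: "indep_var N Y N' Z" and h: "h \<in> measurable N' (count_space UNIV)"
    and unif: "distr M (count_space UNIV) (\<lambda>\<omega>. h (Z \<omega>)) = measure_pmf (pmf_of_set {1..k})" and "k \<ge> 1"
    and f: "f \<in> borel_measurable N" and g: "g \<in> measurable N (count_space UNIV)"
    and int: "integrable M (\<lambda>\<omega>. f (Y \<omega>))"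
    and range: "AE \<omega> in M. g (Y \<omega>) \<in> {1..k}"
  shows "expectation (\<lambda>\<omega>. f (Y \<omega>) * of_bool (h (Z \<omega>) = g (Y \<omega>))) = expectation (\<lambda>\<omega>. f (Y \<omega>)) / real k"
proof -
  note [measurable] = f g h
  have [measurable]: "Y \<in> measurable M N" "Z \<in> measurable M N'"
    using indep by (auto simp: indep_var_eq)
  have [measurable]: "(\<lambda>\<omega>. h (Z \<omega>)) \<in> measurable M (count_space UNIV)"
      "(\<lambda>\<omega>. g (Y \<omega>)) \<in> measurable M (count_space UNIV)"
    by measurable
  define F where "F c y = f y * of_bool (g y = c)" for c y
  have F [measurable]: "F c \<in> borel_measurable N" for c
    unfolding F_def by measurable
  have intF: "integrable M (\<lambda>\<omega>. F c (Y \<omega>))" for c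
    by (rule Bochner_Integration.integrable_bound[OF int]) (auto simp: F_def)
  have intZ: "integrable M (\<lambda>\<omega>. of_bool (h (Z \<omega>) = c) :: real)" for c
    by (rule integrable_const_bound[of _ 1]) auto
  have prob_Z: "expectation (\<lambda>\<omega>. of_bool (h (Z \<omega>) = c) :: real) = 1 / real k" if "c \<in> {1..k}" for c
  proof -
    have "expectation (\<lambda>\<omega>. of_bool (h (Z \<omega>) = c) :: real)
        = integral\<^sup>L (distr M (count_space UNIV) (\<lambda>\<omega>. h (Z \<omega>))) (\<lambda>z. of_bool (z = c))"
      by (subst integral_distr) auto
    also have "\<dots> = measure_pmf.expectation (pmf_of_set {1..k}) (indicator {c})"
      unfolding unif by (intro Bochner_Integration.integral_cong) (auto simp: indicator_def)
    also have "\<dots> = 1 / real k"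
      using that by (simp add: measure_pmf_single)
    finally show ?thesis .
  qed
  have indF: "indep_var borel (\<lambda>\<omega>. F c (Y \<omega>)) borel (\<lambda>\<omega>. of_bool (h (Z \<omega>) = c) :: real)" for c
    using indep_var_compose[OF indep F[of c], of "\<lambda>z. of_bool (h z = c)" borel] by (simp add: comp_def)
  have "expectation (\<lambda>\<omega>. f (Y \<omega>) * of_bool (h (Z \<omega>) = g (Y \<omega>)))
      = expectation (\<lambda>\<omega>. \<Sum>c\<in>{1..k}. F c (Y \<omega>) * of_bool (h (Z \<omega>) = c))"
  proof (rule integral_cong_AE)
    show "AE \<omega> in M. f (Y \<omega>) * of_bool (h (Z \<omega>) = g (Y \<omega>)) = (\<Sum>c\<in>{1..k}. F c (Y \<omega>) * of_bool (h (Z \<omega>) = c))"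
      using range
    proof eventually_elim
      case (elim \<omega>)
      have "(\<Sum>c\<in>{1..k}. F c (Y \<omega>) * of_bool (h (Z \<omega>) = c))
          = (\<Sum>c\<in>{1..k}. if c = g (Y \<omega>) then f (Y \<omega>) * of_bool (h (Z \<omega>) = g (Y \<omega>)) else 0)"
        by (intro sum.cong) (auto simp: F_def)
      then show ?case using elim by simp
    qed
  qed measurable
  also have "\<dots> = (\<Sum>c\<in>{1..k}. expectation (\<lambda>\<omega>. F c (Y \<omega>) * of_bool (h (Z \<omega>) = c)))"
    by (intro Bochner_Integration.integral_sum indep_var_integrable indF intF intZ)
  also have "\<dots> = (\<Sum>c\<in>{1..k}. expectation (\<lambda>\<omega>. F c (Y \<omega>)) / real k)"
    by (intro sum.cong refl) (simp add: indep_var_lebesgue_integral[OF indF intF intZ] prob_Z)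
  also have "\<dots> = expectation (\<lambda>\<omega>. \<Sum>c\<in>{1..k}. F c (Y \<omega>)) / real k"
    by (simp add: Bochner_Integration.integral_sum intF sum_divide_distrib)
  also have "expectation (\<lambda>\<omega>. \<Sum>c\<in>{1..k}. F c (Y \<omega>)) = expectation (\<lambda>\<omega>. f (Y \<omega>))"
  proof (rule integral_cong_AE)
    show "AE \<omega> in M. (\<Sum>c\<in>{1..k}. F c (Y \<omega>)) = f (Y \<omega>)"
      using range by eventually_elim (simp add: F_def of_bool_def if_distrib cong: if_cong)
  qed measurable
  finally show ?thesis .
qed

section \<open>The random words, their history, and the next symbol\<close>

locale random_words = prob_space M for M :: "'a measure" +
  fixes w w' :: "nat \<Rightarrow> 'a \<Rightarrow> nat" and k :: nat
  assumes k_pos: "k \<ge> 1"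
    and indep_words: "indep_vars (\<lambda>_. count_space UNIV) (case_sum w w') UNIV"
    and distr_w: "\<And>n. distr M (count_space UNIV) (w n) = measure_pmf (pmf_of_set {1..k})"
    and distr_w': "\<And>n. distr M (count_space UNIV) (w' n) = measure_pmf (pmf_of_set {1..k})"
begin

lemma measurable_w [measurable]: "w n \<in> measurable M (count_space UNIV)"
  and measurable_w' [measurable]: "w' n \<in> measurable M (count_space UNIV)"
proof -
  have "case_sum w w' i \<in> measurable M (count_space UNIV)" for i
    using indep_words by (simp add: indep_vars_def)
  from this[of "Inl n"] this[of "Inr n"]
  show "w n \<in> measurable M (count_space UNIV)" "w' n \<in> measurable M (count_space UNIV)"
    by simp_all
qed

lemma AE_w_in_alphabet: "AE \<omega> in M. w n \<omega> \<in> {1..k}"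
proof -
  have "AE x in distr M (count_space UNIV) (w n). x \<in> {1..k}"
    unfolding distr_w using k_pos by (simp add: AE_measure_pmf_iff)
  then show ?thesis
    by (subst (asm) AE_distr_iff) auto
qed

abbreviation P :: "nat \<Rightarrow> nat \<Rightarrow> 'a \<Rightarrow> nat" where
  "P d L \<omega> \<equiv> match_length d L (\<lambda>n. w n \<omega>) (\<lambda>n. w' n \<omega>)"

abbreviation gap :: "nat \<Rightarrow> nat \<Rightarrow> 'a \<Rightarrow> real" where
  "gap d L \<omega> \<equiv> match_gap d L (\<lambda>n. w n \<omega>) (\<lambda>n. w' n \<omega>)"

text \<open>By \<open>match_length_le\<close>, these finitely many symbols determine \<open>P d L\<close>, \<open>P (Suc d) L\<close> and the
  symbols of \<open>w\<close> there. Finiteness makes the history space discrete, so that measurability is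
  automatic.\<close>

definition history :: "nat \<Rightarrow> nat \<Rightarrow> 'a \<Rightarrow> nat + nat \<Rightarrow> nat" where
  "history d L \<omega> = restrict (\<lambda>i. case_sum w w' i \<omega>) (Inl ` {..Suc (L + d)} \<union> Inr ` {..<L})"

abbreviation history_space :: "nat \<Rightarrow> nat \<Rightarrow> (nat + nat \<Rightarrow> nat) measure" where
  "history_space d L \<equiv> count_space ((Inl ` {..Suc (L + d)} \<union> Inr ` {..<L}) \<rightarrow>\<^sub>E UNIV)"

text \<open>The index \<open>Inr L\<close> lies outside the history, so these are two disjoint
  blocks of one independent family.\<close>

lemma indep_history:
  "indep_var (history_space d L) (history d L)
    (PiM {Inr L} (\<lambda>_. count_space UNIV)) (\<lambda>\<omega>. restrict (\<lambda>i. case_sum w w' i \<omega>) {Inr L})"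
proof -
  let ?A = "Inl ` {..Suc (L + d)} \<union> Inr ` {..<L} :: (nat + nat) set"
  have "PiM ?A (\<lambda>_. count_space (UNIV :: nat set)) = history_space d L"
    by (rule count_space_PiM_finite) auto
  moreover have "indep_var (PiM ?A (\<lambda>_. count_space UNIV)) (history d L)
      (PiM {Inr L} (\<lambda>_. count_space UNIV)) (\<lambda>\<omega>. restrict (\<lambda>i. case_sum w w' i \<omega>) {Inr L})"
    unfolding history_def by (rule indep_var_restrict[OF indep_words]) auto
  ultimately show ?thesis by simp
qed

lemma match_length_history:
  assumes "e \<le> Suc d"
  shows "match_length e L (\<lambda>n. history d L \<omega> (Inl n)) (\<lambda>n. history d L \<omega> (Inr n)) = P e L \<omega>"
  using assms by (intro match_length_cong) (auto simp: history_def)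

lemma match_gap_history:
  "match_gap d L (\<lambda>n. history d L \<omega> (Inl n)) (\<lambda>n. history d L \<omega> (Inr n)) = gap d L \<omega>"
  by (simp add: match_gap_def match_length_history)

lemma w_at_P_history:
  assumes "e \<le> Suc d"
  shows "history d L \<omega> (Inl (match_length e L (\<lambda>n. history d L \<omega> (Inl n)) (\<lambda>n. history d L \<omega> (Inr n))))
    = w (P e L \<omega>) \<omega>"
proof -
  \<comment> \<open>For \<open>e = Suc d\<close> the position may equal \<open>Suc (L + d)\<close>.
    The history therefore holds one symbol of \<open>w\<close> more than the fronts themselves
    depend on.\<close>
  have "P e L \<omega> \<le> Suc (L + d)"
    using match_length_le[of e L "\<lambda>n. w n \<omega>" "\<lambda>n. w' n \<omega>"] assms by simp
  then show ?thesis
    using assms by (simp add: match_length_history) (simp add: history_def)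
qed

lemma measurable_function_of_history:
  assumes "\<And>\<omega>. X \<omega> = f (history d L \<omega>)" and "space N = UNIV"
  shows "X \<in> measurable M N"
proof -
  have "history d L \<in> measurable M (history_space d L)"
    using indep_history by (simp add: indep_var_eq)
  moreover have "f \<in> measurable (history_space d L) N"
    using assms(2) by simp
  ultimately have "(\<lambda>\<omega>. f (history d L \<omega>)) \<in> measurable M N"
    by (rule measurable_compose)
  moreover have "X = (\<lambda>\<omega>. f (history d L \<omega>))"
    using assms(1) by auto
  ultimately show ?thesis by simp
qed

lemma measurable_gap [measurable]: "gap d L \<in> borel_measurable M"
  by (rule measurable_function_of_history[where d = d and L = L
        and f = "\<lambda>y. match_gap d L (\<lambda>n. y (Inl n)) (\<lambda>n. y (Inr n))"])
    (simp_all add: match_gap_history)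

lemma measurable_w_at_P [measurable]: "(\<lambda>\<omega>. w (P e L \<omega>) \<omega>) \<in> measurable M (count_space UNIV)"
  by (rule measurable_function_of_history[where d = e and L = L
        and f = "\<lambda>y. y (Inl (match_length e L (\<lambda>n. y (Inl n)) (\<lambda>n. y (Inr n))))"])
    (simp_all add: w_at_P_history)

lemma integrable_gap: "integrable M (gap d L)"
  by (rule integrable_const_bound[of _ "real (L + d)"])
    (auto simp: match_gap_nonneg match_gap_le simp del: of_nat_add)

lemma integrable_gap_square: "integrable M (\<lambda>\<omega>. (gap d L \<omega>)\<^sup>2)"
  by (rule integrable_const_bound[of _ "(real (L + d))\<^sup>2"])
    (auto simp: match_gap_nonneg match_gap_le simp del: of_nat_add intro!: power_mono AE_I2)

text \<open>The target symbol is a function of the history, while \<open>w' L\<close> is fresh. The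
  second value is the same for both fronts \<open>e = d\<close> and \<open>e = Suc d\<close>, so the
  gap has no drift in the second-moment recursion.\<close>

lemma expectation_hit:
  assumes "e \<le> Suc d"
  shows "expectation (\<lambda>\<omega>. of_bool (w' L \<omega> = w (P e L \<omega>) \<omega>)) = 1 / real k" (is ?hit)
    and "expectation (\<lambda>\<omega>. gap d L \<omega> * of_bool (w' L \<omega> = w (P e L \<omega>) \<omega>))
      = expectation (gap d L) / real k" (is ?gap_hit)
proof -
  define g :: "(nat + nat \<Rightarrow> nat) \<Rightarrow> nat"
    where "g y = y (Inl (match_length e L (\<lambda>n. y (Inl n)) (\<lambda>n. y (Inr n))))" for y
  have g: "g (history d L \<omega>) = w (P e L \<omega>) \<omega>" for \<omega>
    using assms by (simp add: g_def w_at_P_history)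
  \<comment> \<open>The index \<open>P e L \<omega>\<close> is random, so all \<open>n\<close> are
    needed under a single almost-sure quantifier.\<close>
  have "AE \<omega> in M. \<forall>n. w n \<omega> \<in> {1..k}"
    using AE_w_in_alphabet by (simp add: AE_all_countable)
  then have range: "AE \<omega> in M. g (history d L \<omega>) \<in> {1..k}"
    by eventually_elim (simp add: g)
  have unif: "distr M (count_space UNIV) (\<lambda>\<omega>. restrict (\<lambda>i. case_sum w w' i \<omega>) {Inr L} (Inr L))
      = measure_pmf (pmf_of_set {1..k})"
    by (simp add: distr_w')
  have proj: "(\<lambda>y. y (Inr L :: nat + nat))
      \<in> measurable (PiM {Inr L} (\<lambda>_. count_space UNIV)) (count_space UNIV)"
    by (rule measurable_component_singleton) simp
  have hit: "expectation (\<lambda>\<omega>. f (history d L \<omega>) * of_bool (w' L \<omega> = w (P e L \<omega>) \<omega>))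
      = expectation (\<lambda>\<omega>. f (history d L \<omega>)) / real k"
    if "integrable M (\<lambda>\<omega>. f (history d L \<omega>))" for f :: "_ \<Rightarrow> real"
    using expectation_indep_uniform_hit[where Y = "history d L" and f = f and g = g
        and h = "\<lambda>y. y (Inr L)" and Z = "\<lambda>\<omega>. restrict (\<lambda>i. case_sum w w' i \<omega>) {Inr L}",
        OF indep_history proj unif k_pos _ _ that range]
    by (simp add: g)
  show ?hit
    using hit[of "\<lambda>_. 1"] by (simp add: prob_space)
  show ?gap_hit
    using hit[of "\<lambda>y. match_gap d L (\<lambda>n. y (Inl n)) (\<lambda>n. y (Inr n))"]
    by (simp add: match_gap_history integrable_gap)
qed

section \<open>Second moment of the gap and summation over the deletions\<close>

lemma expectation_gap_square_Suc:
  "expectation (\<lambda>\<omega>. (gap d (Suc L) \<omega>)\<^sup>2) \<le> expectation (\<lambda>\<omega>. (gap d L \<omega>)\<^sup>2) + 2 / real k"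
proof -
  define H where "H e \<omega> = (of_bool (w' L \<omega> = w (P e L \<omega>) \<omega>) :: real)" for e \<omega>
  have [measurable]: "H e \<in> borel_measurable M" for e
    unfolding H_def by measurable
  have intH: "integrable M (H e)" for e
    by (rule integrable_const_bound[of _ 1]) (auto simp: H_def)
  have intGH: "integrable M (\<lambda>\<omega>. gap d L \<omega> * H e \<omega>)" for e
    by (rule Bochner_Integration.integrable_bound[OF integrable_gap[of d L]])
      (auto simp: H_def)
  note ints = intH[of d] intH[of "Suc d"] intGH[of d] intGH[of "Suc d"] integrable_gap_square
  have "expectation (\<lambda>\<omega>. (gap d (Suc L) \<omega>)\<^sup>2)
      \<le> expectation (\<lambda>\<omega>. (gap d L \<omega>)\<^sup>2 + 2 * (gap d L \<omega> * H (Suc d) \<omega> - gap d L \<omega> * H d \<omega>)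
          + H (Suc d) \<omega> + H d \<omega>)"
  proof (rule integral_mono)
    fix \<omega>
    show "(gap d (Suc L) \<omega>)\<^sup>2 \<le> (gap d L \<omega>)\<^sup>2 + 2 * (gap d L \<omega> * H (Suc d) \<omega> - gap d L \<omega> * H d \<omega>)
        + H (Suc d) \<omega> + H d \<omega>"
      unfolding H_def by (rule match_gap_Suc_square_le)
  qed (use ints in simp_all)
  also have "\<dots> = expectation (\<lambda>\<omega>. (gap d L \<omega>)\<^sup>2)
      + 2 * (expectation (\<lambda>\<omega>. gap d L \<omega> * H (Suc d) \<omega>) - expectation (\<lambda>\<omega>. gap d L \<omega> * H d \<omega>))
      + expectation (H (Suc d)) + expectation (H d)"
    using ints by simp
  \<comment> \<open>The two cross terms cancel, and each of the two hits contributes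
    \<open>1 / k\<close>.\<close>
  also have "\<dots> = expectation (\<lambda>\<omega>. (gap d L \<omega>)\<^sup>2) + 2 / real k"
    using expectation_hit[of d d L] expectation_hit[of "Suc d" d L] by (simp add: H_def[abs_def])
  finally show ?thesis .
qed

lemma expectation_gap_square_le: "expectation (\<lambda>\<omega>. (gap d L \<omega>)\<^sup>2) \<le> 2 * real L / real k"
proof (induction L)
  case 0
  then show ?case by (simp add: match_gap_0_right)
next
  case (Suc L)
  then show ?case
    using expectation_gap_square_Suc[of d L] by (simp add: add_divide_distrib algebra_simps)
qed

lemma expectation_gap_le: "expectation (gap d L) \<le> sqrt (2 * real L / real k)"
proof (rule real_le_rsqrt)
  \<comment> \<open>Nonnegativity of the variance bounds the squared mean by the second
    moment.\<close>
  have "0 \<le> expectation (\<lambda>\<omega>. (gap d L \<omega>)\<^sup>2) - (expectation (gap d L))\<^sup>2"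
    using variance_positive[of "gap d L"] variance_eq[OF integrable_gap integrable_gap_square]
    by simp
  then show "(expectation (gap d L))\<^sup>2 \<le> 2 * real L / real k"
    using expectation_gap_square_le[of d L] by simp
qed

lemma expectation_match_length_diff_le:
  "expectation (\<lambda>\<omega>. real (P d L \<omega>) - real (P 0 L \<omega>)) \<le> real d * sqrt (2 * real L / real k) + real d"
proof -
  \<comment> \<open>Telescoping over the number of deletions; each \<open>+ 1\<close> undoes the
    shift in \<open>match_gap\<close>, and together they give the final summand
    \<open>real d\<close>.\<close>
  have "real (P d L \<omega>) - real (P 0 L \<omega>) = (\<Sum>e<d. gap e L \<omega> + 1)" for \<omega>
    by (induction d) (simp_all add: match_gap_def)
  then have "expectation (\<lambda>\<omega>. real (P d L \<omega>) - real (P 0 L \<omega>))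
      = (\<Sum>e<d. expectation (gap e L) + 1)"
    by (simp add: Bochner_Integration.integral_sum integrable_gap prob_space)
  also have "\<dots> \<le> (\<Sum>e<d. sqrt (2 * real L / real k) + 1)"
    by (intro sum_mono add_right_mono expectation_gap_le)
  finally show ?thesis by (simp add: algebra_simps)
qed

end

theorem theorem4:
  fixes M :: "'a measure" and w w' :: "nat \<Rightarrow> 'a \<Rightarrow> nat" and k d L :: nat
  assumes "k \<ge> 1"
    and "prob_space M"
    and "prob_space.indep_vars M (\<lambda>_. count_space UNIV) (case_sum w w') UNIV"
    and "\<And>n. distr M (count_space UNIV) (w n) = measure_pmf (pmf_of_set {1..k})"
    and "\<And>n. distr M (count_space UNIV) (w' n) = measure_pmf (pmf_of_set {1..k})"
  shows "prob_space.expectation M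
           (\<lambda>\<omega>. real (match_length d L (\<lambda>n. w n \<omega>) (\<lambda>n. w' n \<omega>)) - real (match_length 0 L (\<lambda>n. w n \<omega>) (\<lambda>n. w' n \<omega>)))
         \<le> real d * sqrt (2 * real L / real k) + real d"
proof -
  interpret prob_space M by fact
  interpret random_words M w w' k
    using assms by unfold_locales auto
  show ?thesis by (rule expectation_match_length_diff_le)
qed

end
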